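(* There exist absolute constants $C>0$ and $c>0$ such that the following holds. Let $\epsilon \in (0,1)$, let $n$ be an even positive integer, and let $\mathcal{A} \subset {[n] \choose n/2}$ with $\mathcal{A} \neq \emptyset$ and $\mathcal{A} \neq {[n] \choose n/2}$. Suppose further that $$n \geq \frac{C}{\epsilon^2}\left(\log(1/\epsilon)+\log\left(\frac{1}{\mu(\mathcal{A})(1-\mu(\mathcal{A}))}\right)\right).$$ Then, for $r = \lceil \epsilon \sqrt{n} \rceil$, we have $$\mu\left(\partial^{+r}(\mathcal{A})\cap\partial^{+r}(\mathcal{A}^c)\right) \geq c\,\frac{\epsilon^2}{\log \left(\frac{1}{\epsilon\, \mu(\mathcal{A})(1-\mu(\mathcal{A}))}\right)}\,\mu(\mathcal{A})(1-\mu(\mathcal{A})).$$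
   Context: $[n]=\{1,\dots,n\}$ and ${[n] \choose k}$ denotes the set of $k$-element subsets of $[n]$. For $\mathcal{F} \subset {[n] \choose k}$, $\mu(\mathcal{F}) = |\mathcal{F}|/{n \choose k}$ is the uniform measure on the layer ${[n] \choose k}$. $\mathcal{A}^c = {[n] \choose n/2}\setminus \mathcal{A}$. For $\mathcal{A} \subset {[n] \choose k}$ and $r \leq n-k$, the $r$-th iterated upper shadow is $\partial^{+r}(\mathcal{A}) = \{B \in {[n] \choose k+r}: B \supset A \text{ for some } A \in \mathcal{A}\}$; so here $\partial^{+r}(\mathcal{A})\cap\partial^{+r}(\mathcal{A}^c) \subset {[n] \choose n/2+r}$ and $\mu$ of it is taken in that layer. *)

theory Defs
  imports "HOL-Analysis.Analysis"
begin

definition layer :: "nat \<Rightarrow> nat \<Rightarrow> nat set set" where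
  "layer n k = {S. S \<subseteq> {1..n} \<and> card S = k}"

definition mu :: "nat \<Rightarrow> nat \<Rightarrow> nat set set \<Rightarrow> real" where
  "mu n k F = real (card F) / real (n choose k)"

definition upper_shadow :: "nat \<Rightarrow> nat \<Rightarrow> nat \<Rightarrow> nat set set \<Rightarrow> nat set set" where
  "upper_shadow n k r F = {B \<in> layer n (k + r). \<exists>A\<in>F. A \<subseteq> B}"

end

(*
  Let U and V be the sets B in layer n/2 + r all of whose (n/2)-subsets lie in \<A>, respectively in
  the complement of \<A>, and let W be the remaining sets of that layer, i.e. the intersection of the
  two shadows. If u \<in> U and v \<in> V had |v - u| \<le> r, they would share an (n/2)-subset; so U and V
  are at distance > r in the Johnson graph. Apply the Poincare inequality of the Johnson graph
  (spectral gap of order 1/n) to the (1/r)-Lipschitz function min(1, dist(., U)/r): its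
  gradient lives on W and its variance is at least mu(U) mu(V), so mu(W) is at least of order
  eps^2 mu(U) mu(V). By local LYM, mu(U) \<ge> mu(\<A>) - mu(W) and mu(V) \<ge> 1 - mu(\<A>) - mu(W).
  This gives the bound without the logarithm, which is at least 1.
*)

theory Submission
  imports Defs
begin

section \<open>Counting in layers\<close>

lemma finite_layer [simp]: "finite (layer n k)"
  by (rule finite_subset[of _ "Pow {1..n}"]) (auto simp: layer_def)

lemma card_layer [simp]: "card (layer n k) = n choose k"
  using n_subsets[of "{1..n}" k] by (simp add: layer_def)

lemma finite_mem_layer: "S \<in> layer n k \<Longrightarrow> finite S"
  by (auto simp: layer_def intro: finite_subset)

lemma card_layer_above:
  assumes "S \<in> layer n k"
  shows "card {B \<in> layer n (k + r). S \<subseteq> B} = (n - k) choose r"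
proof -
  have S: "S \<subseteq> {1..n}" "card S = k" "finite S"
    using assms finite_mem_layer[OF assms] by (auto simp: layer_def)
  have "bij_betw (\<lambda>T. S \<union> T) {T. T \<subseteq> {1..n} - S \<and> card T = r} {B \<in> layer n (k + r). S \<subseteq> B}"
  proof (rule bij_betw_byWitness[where f' = "\<lambda>B. B - S"])
    show "(\<union>) S ` {T. T \<subseteq> {1..n} - S \<and> card T = r} \<subseteq> {B \<in> layer n (k + r). S \<subseteq> B}"
    proof (rule image_subsetI)
      fix T assume "T \<in> {T. T \<subseteq> {1..n} - S \<and> card T = r}"
      then have T: "T \<subseteq> {1..n} - S" "card T = r" by auto
      then have "finite T" by (auto intro: finite_subset)
      moreover have "S \<inter> T = {}" using T by auto
      ultimately show "S \<union> T \<in> {B \<in> layer n (k + r). S \<subseteq> B}"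
        using T S by (auto simp: layer_def card_Un_disjoint)
    qed
    show "(\<lambda>B. B - S) ` {B \<in> layer n (k + r). S \<subseteq> B} \<subseteq> {T. T \<subseteq> {1..n} - S \<and> card T = r}"
      using S by (auto simp: layer_def card_Diff_subset)
  qed (use S in auto)
  then have "card {B \<in> layer n (k + r). S \<subseteq> B} = card {T. T \<subseteq> {1..n} - S \<and> card T = r}"
    by (simp add: bij_betw_same_card)
  also have "\<dots> = card ({1..n} - S) choose r"
    by (rule n_subsets) simp
  also have "card ({1..n} - S) = n - k"
    using S by (simp add: card_Diff_subset)
  finally show ?thesis .
qed

lemma card_layer_below:
  assumes "B \<in> layer n m"
  shows "card {S \<in> layer n k. S \<subseteq> B} = m choose k"
proof -
  have "{S \<in> layer n k. S \<subseteq> B} = {S. S \<subseteq> B \<and> card S = k}"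
    using assms by (auto simp: layer_def)
  then show ?thesis
    using n_subsets[of B k] finite_mem_layer[OF assms] assms by (simp add: layer_def)
qed

section \<open>Inclusion operators between layers and their spectral gap\<close>

lemma sum_filter_swap:
  fixes h :: "'a \<Rightarrow> 'b \<Rightarrow> real"
  assumes "finite A" "finite B"
  shows "(\<Sum>x\<in>A. \<Sum>y | y \<in> B \<and> R x y. h x y) = (\<Sum>y\<in>B. \<Sum>x | x \<in> A \<and> R x y. h x y)"
  using sum.swap_restrict[OF assms] .

text \<open>The index \<open>k\<close> names the layer where \<open>f\<close> lives; the layer of
  the argument \<open>z\<close> is left free. Between adjacent layers, this and
  \<open>up_sum\<close> are the unnormalised inclusion operators, adjoint to each other.\<close>

definition down_sum :: "nat \<Rightarrow> nat \<Rightarrow> (nat set \<Rightarrow> real) \<Rightarrow> nat set \<Rightarrow> real" where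
  "down_sum n k f z = (\<Sum>y | y \<in> layer n k \<and> z \<subseteq> y. f y)"

definition up_sum :: "nat \<Rightarrow> nat \<Rightarrow> (nat set \<Rightarrow> real) \<Rightarrow> nat set \<Rightarrow> real" where
  "up_sum n k f x = (\<Sum>y | y \<in> layer n k \<and> y \<subseteq> x. f y)"

text \<open>Expanding the square turns the norm of an inclusion operator into a quadratic form whose
  kernel counts common neighbours, so two norms can be compared by comparing counts.\<close>

lemma sum_power2_filter:
  fixes f :: "'a \<Rightarrow> real"
  assumes "finite A" "finite B"
  shows "(\<Sum>x\<in>A. (\<Sum>y | y \<in> B \<and> R x y. f y)\<^sup>2)
    = (\<Sum>y\<in>B. \<Sum>y'\<in>B. real (card {x \<in> A. R x y \<and> R x y'}) * (f y * f y'))"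
proof -
  have "(\<Sum>x\<in>A. (\<Sum>y | y \<in> B \<and> R x y. f y)\<^sup>2)
    = (\<Sum>x\<in>A. \<Sum>y\<in>B. \<Sum>y'\<in>B. if R x y \<and> R x y' then f y * f y' else 0)"
  proof (rule sum.cong[OF refl])
    fix x
    have "(\<Sum>y | y \<in> B \<and> R x y. f y) = (\<Sum>y\<in>B. if R x y then f y else 0)"
      by (rule sum.inter_filter[OF assms(2)])
    then show "(\<Sum>y | y \<in> B \<and> R x y. f y)\<^sup>2
      = (\<Sum>y\<in>B. \<Sum>y'\<in>B. if R x y \<and> R x y' then f y * f y' else 0)"
      by (auto simp: power2_eq_square sum_product intro!: sum.cong)
  qed
  also have "\<dots> = (\<Sum>y\<in>B. \<Sum>x\<in>A. \<Sum>y'\<in>B. if R x y \<and> R x y' then f y * f y' else 0)"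
    by (rule sum.swap)
  also have "\<dots> = (\<Sum>y\<in>B. \<Sum>y'\<in>B. \<Sum>x\<in>A. if R x y \<and> R x y' then f y * f y' else 0)"
    by (intro sum.cong refl) (rule sum.swap)
  also have "\<dots> = (\<Sum>y\<in>B. \<Sum>y'\<in>B. real (card {x \<in> A. R x y \<and> R x y'}) * (f y * f y'))"
    by (intro sum.cong refl) (simp add: sum.inter_filter[OF assms(1), symmetric])
  finally show ?thesis .
qed

text \<open>Two distinct sets of size \<open>k + 1\<close> have a common superset of size \<open>k + 2\<close> iff they have
  a common subset of size \<open>k\<close>, and it is then unique.\<close>

lemma card_common_above_below:
  assumes y: "y \<in> layer n (Suc k)" and y': "y' \<in> layer n (Suc k)"
  shows "real (card {x \<in> layer n (Suc (Suc k)). y \<subseteq> x \<and> y' \<subseteq> x})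
    = real (card {z \<in> layer n k. z \<subseteq> y \<and> z \<subseteq> y'})
      + (if y = y' then real n - 2 * real k - 2 else 0)"
proof (cases "y = y'")
  case True
  have "Suc k \<le> n"
    using y card_mono[of "{1..n}" y] by (auto simp: layer_def)
  then show ?thesis
    using True card_layer_above[OF y, of 1] card_layer_below[OF y, of k]
    by (simp add: of_nat_diff)
next
  case False
  have fin: "finite y" "finite y'" and c: "card y = Suc k" "card y' = Suc k"
    and s: "y \<subseteq> {1..n}" "y' \<subseteq> {1..n}"
    using y y' finite_mem_layer[OF y] finite_mem_layer[OF y'] by (auto simp: layer_def)
  have sum: "card (y \<union> y') + card (y \<inter> y') = 2 * k + 2"
    using card_Un_Int[OF fin] c by simp
  have "\<not> y' \<subseteq> y"
    using False c fin card_subset_eq by metis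
  then have "card (y \<inter> y') < card y'"
    using fin by (intro psubset_card_mono) auto
  then have le: "card (y \<inter> y') \<le> k" using c by simp
  have "{x \<in> layer n (Suc (Suc k)). y \<subseteq> x \<and> y' \<subseteq> x}
      = (if card (y \<inter> y') = k then {y \<union> y'} else {})"
  proof -
    have "x = y \<union> y' \<and> card (y \<inter> y') = k"
      if x: "x \<in> layer n (Suc (Suc k))" "y \<subseteq> x" "y' \<subseteq> x" for x
    proof -
      have "card (y \<union> y') \<le> card x" "finite x"
        using x finite_mem_layer by (auto intro!: card_mono)
      moreover have "card x = Suc (Suc k)" using x by (simp add: layer_def)
      ultimately have "card (y \<union> y') = card x" "card (y \<inter> y') = k"
        using sum le by linarith+
      then show ?thesis using x \<open>finite x\<close> card_subset_eq[of x "y \<union> y'"] by auto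
    qed
    moreover have "y \<union> y' \<in> layer n (Suc (Suc k))" if "card (y \<inter> y') = k"
      using that sum s by (auto simp: layer_def)
    ultimately show ?thesis by auto
  qed
  moreover have "{z \<in> layer n k. z \<subseteq> y \<and> z \<subseteq> y'}
      = (if card (y \<inter> y') = k then {y \<inter> y'} else {})"
  proof -
    have "z = y \<inter> y' \<and> card (y \<inter> y') = k"
      if z: "z \<in> layer n k" "z \<subseteq> y" "z \<subseteq> y'" for z
    proof -
      have "card z \<le> card (y \<inter> y')"
        using z fin by (auto intro!: card_mono)
      moreover have "card z = k" using z by (simp add: layer_def)
      ultimately have "card z = card (y \<inter> y')" "card (y \<inter> y') = k"
        using le by linarith+
      then show ?thesis using z fin card_subset_eq[of "y \<inter> y'" z] by auto
    qed
    moreover have "y \<inter> y' \<in> layer n k" if "card (y \<inter> y') = k"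
      using that s by (auto simp: layer_def)
    ultimately show ?thesis by auto
  qed
  ultimately show ?thesis using False by simp
qed

text \<open>Quadratic form of the commutation relation of the Boolean lattice. The kernels of the
  two norms agree off the diagonal; on it they differ by (n - k - 1) - (k + 1), supersets minus
  subsets.\<close>

lemma up_sum_norm_eq:
  "(\<Sum>x\<in>layer n (Suc (Suc k)). (up_sum n (Suc k) g x)\<^sup>2)
    = (\<Sum>z\<in>layer n k. (down_sum n (Suc k) g z)\<^sup>2)
      + (real n - 2 * real k - 2) * (\<Sum>y\<in>layer n (Suc k). (g y)\<^sup>2)"
proof -
  let ?L = "layer n (Suc k)"
  let ?b = "\<lambda>y y'. real (card {z \<in> layer n k. z \<subseteq> y \<and> z \<subseteq> y'})"
  let ?c = "real n - 2 * real k - 2"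
  have "(\<Sum>x\<in>layer n (Suc (Suc k)). (up_sum n (Suc k) g x)\<^sup>2)
    = (\<Sum>y\<in>?L. \<Sum>y'\<in>?L. real (card {x \<in> layer n (Suc (Suc k)). y \<subseteq> x \<and> y' \<subseteq> x}) * (g y * g y'))"
    unfolding up_sum_def by (rule sum_power2_filter) auto
  also have "\<dots> = (\<Sum>y\<in>?L. \<Sum>y'\<in>?L. ?b y y' * (g y * g y') + (if y = y' then ?c * (g y)\<^sup>2 else 0))"
    by (intro sum.cong refl)
      (simp add: card_common_above_below distrib_right power2_eq_square)
  also have "\<dots> = (\<Sum>y\<in>?L. \<Sum>y'\<in>?L. ?b y y' * (g y * g y')) + (\<Sum>y\<in>?L. ?c * (g y)\<^sup>2)"
    by (simp add: sum.distrib)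
  also have "(\<Sum>y\<in>?L. \<Sum>y'\<in>?L. ?b y y' * (g y * g y')) = (\<Sum>z\<in>layer n k. (down_sum n (Suc k) g z)\<^sup>2)"
    unfolding down_sum_def by (rule sum_power2_filter[symmetric]) auto
  finally show ?thesis by (simp add: sum_distrib_left)
qed

text \<open>Each \<open>x\<close> has k + 1 subsets one layer down. Hence \<open>down_sum\<close>
  keeps a zero total at zero, which lets the induction on the layer continue.\<close>

lemma sum_down_sum:
  "(\<Sum>z\<in>layer n k. down_sum n (Suc k) f z) = real (Suc k) * (\<Sum>x\<in>layer n (Suc k). f x)"
proof -
  have "(\<Sum>z\<in>layer n k. down_sum n (Suc k) f z)
      = (\<Sum>x\<in>layer n (Suc k). \<Sum>z | z \<in> layer n k \<and> z \<subseteq> x. f x)"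
    unfolding down_sum_def by (rule sum_filter_swap) auto
  also have "\<dots> = (\<Sum>x\<in>layer n (Suc k). real (Suc k) * f x)"
    by (intro sum.cong refl) (simp add: card_layer_below)
  finally show ?thesis by (simp add: sum_distrib_left)
qed

lemma sum_down_sum_mult:
  "(\<Sum>z\<in>layer n k. down_sum n m f z * g z) = (\<Sum>x\<in>layer n m. f x * up_sum n k g x)"
  unfolding down_sum_def up_sum_def sum_distrib_left sum_distrib_right
  by (rule sum_filter_swap) auto

text \<open>Second eigenvalue of the down-up walk, by induction on the layer: passing from
  \<open>up_sum\<close> to its adjoint \<open>down_sum\<close> preserves the norm bound, and the commutation relation
  \<open>up_sum_norm_eq\<close> moves it up one layer.\<close>

lemma down_sum_norm_le:
  assumes "Suc k \<le> n" and "(\<Sum>x\<in>layer n (Suc k). f x) = 0"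
  shows "(\<Sum>z\<in>layer n k. (down_sum n (Suc k) f z)\<^sup>2)
    \<le> real k * (real n - real k - 1) * (\<Sum>x\<in>layer n (Suc k). (f x)\<^sup>2)"
  using assms
proof (induction k arbitrary: f)
  case 0
  have [simp]: "layer n 0 = {{}}"
    by (auto simp: layer_def dest: finite_subset)
  have "down_sum n (Suc 0) f {} = 0"
    using 0 by (simp add: down_sum_def)
  then show ?case by simp
next
  case (Suc k)
  define g where "g = down_sum n (Suc (Suc k)) f"
  define G where "G = (\<Sum>y\<in>layer n (Suc k). (g y)\<^sup>2)"
  define F where "F = (\<Sum>x\<in>layer n (Suc (Suc k)). (f x)\<^sup>2)"
  define l where "l = real (Suc k) * (real n - real (Suc k) - 1)"
  have "(\<Sum>y\<in>layer n (Suc k). g y) = 0"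
    using sum_down_sum[of n "Suc k" f] Suc.prems by (simp add: g_def)
  then have "(\<Sum>z\<in>layer n k. (down_sum n (Suc k) g z)\<^sup>2) \<le> real k * (real n - real k - 1) * G"
    using Suc.IH[of g] Suc.prems by (simp add: G_def)
  \<comment> \<open>The recursion closes because k(n - k - 1) + (n - 2k - 2) = (k + 1)(n - k - 2),
    which is \<open>l\<close>.\<close>
  then have up: "(\<Sum>x\<in>layer n (Suc (Suc k)). (up_sum n (Suc k) g x)\<^sup>2) \<le> l * G"
    unfolding up_sum_norm_eq G_def[symmetric] l_def by (simp add: algebra_simps)
  have "G = (\<Sum>x\<in>layer n (Suc (Suc k)). f x * up_sum n (Suc k) g x)"
    using sum_down_sum_mult[where n = n and k = "Suc k" and m = "Suc (Suc k)" and f = f and g = g]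
    by (simp add: G_def g_def power2_eq_square)
  \<comment> \<open>Cauchy-Schwarz on \<open>G\<close> = <f, up g>. The bound on the norm of up g
    again contains \<open>G\<close>, and one factor \<open>G\<close> is cancelled at the
    end.\<close>
  then have "G\<^sup>2 \<le> F * (\<Sum>x\<in>layer n (Suc (Suc k)). (up_sum n (Suc k) g x)\<^sup>2)"
    using Cauchy_Schwarz_ineq_sum[of f "up_sum n (Suc k) g" "layer n (Suc (Suc k))"]
    by (simp add: F_def)
  also have "\<dots> \<le> F * (l * G)"
    by (intro mult_left_mono up) (simp add: F_def sum_nonneg)
  finally have "G * G \<le> (l * F) * G" by (simp add: power2_eq_square mult_ac)
  moreover have "G \<ge> 0" "F \<ge> 0" "l \<ge> 0"
    using Suc.prems by (auto simp: G_def F_def l_def sum_nonneg)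
  ultimately have "G \<le> l * F"
    by (cases "G = 0") auto
  then show ?case by (simp add: G_def F_def l_def g_def)
qed

section \<open>Poincare inequality of the Johnson graph\<close>

lemma sum_sum_diff_power2:
  fixes f :: "'a \<Rightarrow> real"
  shows "(\<Sum>y\<in>Y. \<Sum>y'\<in>Y. (f y - f y')\<^sup>2)
    = 2 * real (card Y) * (\<Sum>y\<in>Y. (f y)\<^sup>2) - 2 * (\<Sum>y\<in>Y. f y)\<^sup>2"
proof -
  define S where "S = (\<Sum>y\<in>Y. f y)"
  have "(\<Sum>y\<in>Y. \<Sum>y'\<in>Y. (f y - f y')\<^sup>2)
      = (\<Sum>y\<in>Y. real (card Y) * (f y)\<^sup>2 + (\<Sum>y'\<in>Y. (f y')\<^sup>2) - 2 * (f y * S))"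
    by (simp add: S_def power2_diff sum.distrib sum_subtractf sum_distrib_left mult.assoc)
  also have "\<dots> = real (card Y) * (\<Sum>y\<in>Y. (f y)\<^sup>2) + real (card Y) * (\<Sum>y'\<in>Y. (f y')\<^sup>2)
      - 2 * ((\<Sum>y\<in>Y. f y) * S)"
    by (simp add: sum.distrib sum_subtractf sum_distrib_left[symmetric] sum_distrib_right[symmetric])
  finally show ?thesis by (simp add: S_def power2_eq_square)
qed

lemma sum_above:
  fixes f :: "nat set \<Rightarrow> real"
  shows "(\<Sum>z\<in>layer n k. \<Sum>y | y \<in> layer n (Suc k) \<and> z \<subseteq> y. f y)
    = real (Suc k) * (\<Sum>x\<in>layer n (Suc k). f x)"
  using sum_down_sum[of n k f] by (simp add: down_sum_def)

text \<open>Two distinct sets adjacent in the Johnson graph have exactly one common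
  \<open>z\<close>, so the right side is the Dirichlet form with every edge taken in both orders.
  Expanding it around each \<open>z\<close> leaves the norm of the centred function minus its
  \<open>down_sum\<close> norm, which \<open>down_sum_norm_le\<close> controls.\<close>

lemma johnson_poincare:
  fixes f :: "nat set \<Rightarrow> real"
  assumes k: "Suc k \<le> n"
  defines "m \<equiv> (\<Sum>x\<in>layer n (Suc k). f x) / real (n choose Suc k)"
  shows "2 * real n * (\<Sum>x\<in>layer n (Suc k). (f x - m)\<^sup>2)
    \<le> (\<Sum>z\<in>layer n k. \<Sum>y | y \<in> layer n (Suc k) \<and> z \<subseteq> y.
        \<Sum>y' | y' \<in> layer n (Suc k) \<and> z \<subseteq> y'. (f y - f y')\<^sup>2)"
proof -
  let ?Y = "\<lambda>z. {y. y \<in> layer n (Suc k) \<and> z \<subseteq> y}"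
  define h where "h x = f x - m" for x
  define H where "H = (\<Sum>x\<in>layer n (Suc k). (h x)\<^sup>2)"
  have "n choose Suc k > 0" using k by simp
  then have h0: "(\<Sum>x\<in>layer n (Suc k). h x) = 0"
    by (simp add: h_def m_def sum_subtractf del: binomial_Suc_Suc)
  have "(\<Sum>z\<in>layer n k. \<Sum>y\<in>?Y z. \<Sum>y'\<in>?Y z. (f y - f y')\<^sup>2)
    = (\<Sum>z\<in>layer n k. \<Sum>y\<in>?Y z. \<Sum>y'\<in>?Y z. (h y - h y')\<^sup>2)"
    by (simp add: h_def)
  also have "\<dots> = (\<Sum>z\<in>layer n k. 2 * real (n - k) * (\<Sum>y\<in>?Y z. (h y)\<^sup>2) - 2 * (down_sum n (Suc k) h z)\<^sup>2)"
  proof (intro sum.cong refl)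
    fix z assume "z \<in> layer n k"
    then have "card (?Y z) = n - k"
      using card_layer_above[of z n k 1] by simp
    then show "(\<Sum>y\<in>?Y z. \<Sum>y'\<in>?Y z. (h y - h y')\<^sup>2)
      = 2 * real (n - k) * (\<Sum>y\<in>?Y z. (h y)\<^sup>2) - 2 * (down_sum n (Suc k) h z)\<^sup>2"
      unfolding sum_sum_diff_power2 down_sum_def by simp
  qed
  also have "\<dots> = 2 * real (n - k) * (real (Suc k) * H)
      - 2 * (\<Sum>z\<in>layer n k. (down_sum n (Suc k) h z)\<^sup>2)"
    unfolding sum_subtractf sum_distrib_left[symmetric] sum_above H_def ..
  also have "\<dots> \<ge> 2 * real (n - k) * (real (Suc k) * H)
      - 2 * (real k * (real n - real k - 1) * H)"
    using down_sum_norm_le[OF k h0] by (simp add: H_def)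
  \<comment> \<open>The gap: (n - k)(k + 1) - k(n - k - 1) = n.\<close>
  also have "2 * real (n - k) * (real (Suc k) * H) - 2 * (real k * (real n - real k - 1) * H)
      = 2 * real n * H"
    using k by (simp add: of_nat_diff algebra_simps)
  finally show ?thesis by (simp add: H_def h_def)
qed

section \<open>Separated sets in the Johnson graph\<close>

text \<open>Poincare applied to the truncated distance from \<open>U\<close>. The factor (k + 1)(n -
  k) counts, for a fixed y, the pairs (z, y') with z below both y and y'; this is how often a point
  outside \<open>U\<close> and \<open>V\<close> can be charged in each order.\<close>

lemma separated_sets_le:
  assumes k: "Suc k \<le> n" and r: "r \<ge> 1"
    and U: "U \<subseteq> layer n (Suc k)" "U \<noteq> {}" and V: "V \<subseteq> layer n (Suc k)" "V \<noteq> {}"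
    and sep: "\<And>u v. u \<in> U \<Longrightarrow> v \<in> V \<Longrightarrow> card (v - u) > r"
  shows "real n * (real (card U) * real (card V)) * (real r)\<^sup>2
    \<le> real (Suc k) * real (n - k) * real (card (layer n (Suc k) - U - V)) * real (n choose Suc k)"
proof -
  let ?L = "layer n (Suc k)"
  let ?Y = "\<lambda>z. {y. y \<in> ?L \<and> z \<subseteq> y}"
  define W where "W = ?L - U - V"
  \<comment> \<open>For sets of equal size, \<open>card (x - u)\<close> is half the symmetric
    difference, i.e. the Johnson distance.\<close>
  define d where "d x = Min ((\<lambda>u. card (x - u)) ` U)" for x
  define f where "f x = min 1 (real (d x) / real r)" for x
  define m where "m = (\<Sum>x\<in>?L. f x) / real (n choose Suc k)"
  have fin: "finite U" "finite V" "finite W"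
    using U V by (auto simp: W_def intro: finite_subset)
  have U0: "f u = 0" if "u \<in> U" for u
  proof -
    have "d u \<le> card (u - u)"
      unfolding d_def by (intro Min_le finite_imageI fin imageI that)
    then show ?thesis by (simp add: f_def)
  qed
  have V1: "f v = 1" if "v \<in> V" for v
  proof -
    have "d v \<in> (\<lambda>u. card (v - u)) ` U" unfolding d_def using U fin by (intro Min_in) auto
    then have "d v \<ge> r" using sep[OF _ that] by fastforce
    then show ?thesis using r by (simp add: f_def)
  qed
  have near: "card (y - y') \<le> 1" if "z \<in> layer n k" "y \<in> ?Y z" "y' \<in> ?Y z" for y y' z
  proof -
    have "card (y - y') \<le> card (y - z)"
      using that finite_mem_layer by (intro card_mono) auto
    also have "\<dots> = 1"
      using that finite_mem_layer[of z] by (subst card_Diff_subset) (auto simp: layer_def)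
    finally show ?thesis .
  qed
  have lip: "f y \<le> f y' + 1 / real r" if z: "z \<in> layer n k" "y \<in> ?Y z" "y' \<in> ?Y z" for y y' z
  proof -
    have "d y' \<in> (\<lambda>u. card (y' - u)) ` U" unfolding d_def using U fin by (intro Min_in) auto
    then obtain u where u: "u \<in> U" "d y' = card (y' - u)" by auto
    have "d y \<le> card (y - u)" unfolding d_def using u fin by (intro Min_le) auto
    also have "\<dots> \<le> card ((y - y') \<union> (y' - u))"
      using z finite_mem_layer by (intro card_mono) auto
    also have "\<dots> \<le> card (y - y') + card (y' - u)" by (rule card_Un_le)
    also have "\<dots> \<le> 1 + d y'" using near[OF z] u by simp
    finally have "real (d y) / real r \<le> (1 + real (d y')) / real r"
      by (intro divide_right_mono) auto
    moreover have "1 / real r \<ge> 0" by simp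
    ultimately show ?thesis unfolding f_def add_divide_distrib by linarith
  qed
  have edge: "(f y - f y')\<^sup>2 \<le> (indicator W y + indicator W y') / (real r)\<^sup>2"
    if z: "z \<in> layer n k" "y \<in> ?Y z" "y' \<in> ?Y z" for y y' z
  proof (cases "y \<in> W \<or> y' \<in> W")
    case True
    have "\<bar>f y - f y'\<bar> \<le> 1 / real r" using lip[OF z] lip[OF z(1,3,2)] by linarith
    then have "\<bar>f y - f y'\<bar>\<^sup>2 \<le> (1 / real r)\<^sup>2" by (intro power_mono) auto
    also have "\<dots> = 1 / (real r)\<^sup>2" by (simp add: power_divide)
    also have "\<dots> \<le> (indicator W y + indicator W y') / (real r)\<^sup>2"
      using True by (intro divide_right_mono) (auto simp: indicator_def)
    finally show ?thesis by simp
  next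
    case False
    then have "y \<in> U \<or> y \<in> V" "y' \<in> U \<or> y' \<in> V" using z by (auto simp: W_def)
    \<comment> \<open>Neighbours are at distance at most 1 \<le> r, so no edge joins
      \<open>U\<close> to \<open>V\<close>.\<close>
    moreover have "\<not> (y \<in> U \<and> y' \<in> V)" "\<not> (y \<in> V \<and> y' \<in> U)"
      using sep near[OF z] near[OF z(1,3,2)] r by (meson leD le_trans)+
    ultimately have "f y = f y'" using U0 V1 by auto
    then show ?thesis by simp
  qed
  have "2 * real n * (\<Sum>x\<in>?L. (f x - m)\<^sup>2)
    \<le> (\<Sum>z\<in>layer n k. \<Sum>y\<in>?Y z. \<Sum>y'\<in>?Y z. (f y - f y')\<^sup>2)"
    unfolding m_def by (rule johnson_poincare[OF k])
  also have "\<dots> \<le> (\<Sum>z\<in>layer n k. \<Sum>y\<in>?Y z. \<Sum>y'\<in>?Y z. (indicator W y + indicator W y') / (real r)\<^sup>2)"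
    by (intro sum_mono edge)
  \<comment> \<open>The two indicators contribute equally by symmetry, each with n - k choices for
    the other endpoint.\<close>
  also have "\<dots> = (\<Sum>z\<in>layer n k. 2 * real (n - k) / (real r)\<^sup>2 * (\<Sum>y\<in>?Y z. indicator W y))"
  proof (intro sum.cong refl)
    fix z assume "z \<in> layer n k"
    then have "card (?Y z) = n - k"
      using card_layer_above[of z n k 1] by simp
    then show "(\<Sum>y\<in>?Y z. \<Sum>y'\<in>?Y z. (indicator W y + indicator W y') / (real r)\<^sup>2)
      = 2 * real (n - k) / (real r)\<^sup>2 * (\<Sum>y\<in>?Y z. indicator W y)"
      by (simp add: sum_divide_distrib[symmetric] sum.distrib sum_distrib_left[symmetric])
  qed
  also have "\<dots> = 2 * real (n - k) / (real r)\<^sup>2 * (real (Suc k) * (\<Sum>y\<in>?L. indicator W y))"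
    unfolding sum_distrib_left[symmetric] sum_above ..
  also have "(\<Sum>y\<in>?L. indicator W y :: real) = real (card W)"
  proof -
    have "?L \<inter> W = W" by (auto simp: W_def)
    then show ?thesis
      by (simp add: sum.inter_restrict[symmetric] indicator_def of_bool_def)
  qed
  finally have poin: "real n * (\<Sum>x\<in>?L. (f x - m)\<^sup>2) * (real r)\<^sup>2
      \<le> real (Suc k) * real (n - k) * real (card W)"
    using r by (simp add: field_simps)
  have disj: "U \<inter> V = {}"
  proof -
    have "card (u - u) > r" if "u \<in> U" "u \<in> V" for u using sep that by blast
    then show ?thesis by auto
  qed
  define u v where "u = real (card U)" and "v = real (card V)"
  have uv: "u + v \<le> real (n choose Suc k)" "u > 0" "v > 0"
  proof -
    have "card (U \<union> V) \<le> card ?L" using U V by (intro card_mono) auto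
    then have "card U + card V \<le> n choose Suc k"
      by (simp only: card_layer card_Un_disjoint[OF fin(1,2) disj])
    then show "u + v \<le> real (n choose Suc k)"
      unfolding u_def v_def by (metis of_nat_add of_nat_le_iff)
    show "u > 0" "v > 0" using U V fin by (auto simp: u_def v_def card_gt_0_iff)
  qed
  \<comment> \<open>Variance from below: only the points of \<open>U\<close>, where \<open>f\<close>
    is 0, and of \<open>V\<close>, where \<open>f\<close> is 1, are kept.\<close>
  have "u * m\<^sup>2 + v * (1 - m)\<^sup>2 = (\<Sum>x\<in>U \<union> V. (f x - m)\<^sup>2)"
    using U0 V1 by (simp add: sum.union_disjoint[OF fin(1,2) disj] u_def v_def)
  also have "\<dots> \<le> (\<Sum>x\<in>?L. (f x - m)\<^sup>2)"
    using U V by (intro sum_mono2) auto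
  finally have var: "u * m\<^sup>2 + v * (1 - m)\<^sup>2 \<le> (\<Sum>x\<in>?L. (f x - m)\<^sup>2)" .
  \<comment> \<open>Completing the square in \<open>m\<close> shows that the kept variance is at
    least uv/(u + v), whatever the mean is.\<close>
  have "u * v \<le> u * v + ((u + v) * m - v)\<^sup>2" by simp
  also have "\<dots> = (u + v) * (u * m\<^sup>2 + v * (1 - m)\<^sup>2)"
    by (simp add: algebra_simps power2_eq_square)
  also have "\<dots> \<le> real (n choose Suc k) * (\<Sum>x\<in>?L. (f x - m)\<^sup>2)"
    using uv var by (intro mult_mono) auto
  finally have "real n * (u * v) * (real r)\<^sup>2
      \<le> real n * (real (n choose Suc k) * (\<Sum>x\<in>?L. (f x - m)\<^sup>2)) * (real r)\<^sup>2"
    by (intro mult_left_mono mult_right_mono) auto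
  also have "\<dots> = real (n choose Suc k) * (real n * (\<Sum>x\<in>?L. (f x - m)\<^sup>2) * (real r)\<^sup>2)"
    by (simp only: mult_ac)
  also have "\<dots> \<le> real (n choose Suc k) * (real (Suc k) * real (n - k) * real (card W))"
    by (intro mult_left_mono poin) simp
  finally show ?thesis by (simp only: u_def v_def W_def mult_ac)
qed

section \<open>Local LYM and the intersection of the two shadows\<close>

text \<open>Double count the pairs A \<subseteq> B with A in \<open>F\<close>: each A lies in
  exactly (n - k choose r) sets B of the shadow, and each B contains at most (k + r choose k) sets
  A.\<close>

lemma mu_upper_shadow_ge:
  assumes F: "F \<subseteq> layer n k" and kr: "k + r \<le> n"
  shows "mu n k F \<le> mu n (k + r) (upper_shadow n k r F)"
proof -
  let ?S = "upper_shadow n k r F"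
  have fin: "finite F" "finite ?S" using F by (auto simp: upper_shadow_def intro: finite_subset)
  have "real (card F) * real ((n - k) choose r) = (\<Sum>A\<in>F. \<Sum>B | B \<in> ?S \<and> A \<subseteq> B. 1)"
  proof -
    have "{B. B \<in> ?S \<and> A \<subseteq> B} = {B \<in> layer n (k + r). A \<subseteq> B}" if "A \<in> F" for A
      using that by (auto simp: upper_shadow_def)
    then have "(\<Sum>B | B \<in> ?S \<and> A \<subseteq> B. 1) = real ((n - k) choose r)" if "A \<in> F" for A
      using card_layer_above[of A n k r] that F by auto
    then show ?thesis by simp
  qed
  also have "\<dots> = (\<Sum>B\<in>?S. \<Sum>A | A \<in> F \<and> A \<subseteq> B. 1)"
    by (rule sum_filter_swap[OF fin])
  also have "\<dots> \<le> (\<Sum>B\<in>?S. real ((k + r) choose k))"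
  proof (rule sum_mono)
    fix B assume "B \<in> ?S"
    then have B: "B \<in> layer n (k + r)" by (simp add: upper_shadow_def)
    have "card {A. A \<in> F \<and> A \<subseteq> B} \<le> card {A \<in> layer n k. A \<subseteq> B}"
      using F by (intro card_mono) auto
    then show "(\<Sum>A | A \<in> F \<and> A \<subseteq> B. 1) \<le> real ((k + r) choose k)"
      using card_layer_below[OF B, of k] by simp
  qed
  finally have main: "real (card F) * real ((n - k) choose r)
      \<le> real (card ?S) * real ((k + r) choose k)" by simp
  have "(n choose (k + r)) * ((k + r) choose k) = (n choose k) * ((n - k) choose r)"
    using choose_mult[of k "k + r" n] kr by simp
  then have id: "real (n choose (k + r)) * real ((k + r) choose k)
      = real (n choose k) * real ((n - k) choose r)"
    by (metis of_nat_mult)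
  have pos: "real (n choose k) > 0" "real (n choose (k + r)) > 0" "real ((k + r) choose k) > 0"
    using kr by auto
  have "real (card F) * real (n choose (k + r)) * real ((k + r) choose k)
      = real (n choose k) * (real (card F) * real ((n - k) choose r))"
    using id by (simp add: mult_ac)
  also have "\<dots> \<le> real (n choose k) * (real (card ?S) * real ((k + r) choose k))"
    by (intro mult_left_mono main) simp
  finally have "real (card F) * real (n choose (k + r)) \<le> real (n choose k) * real (card ?S)"
    using pos by (simp add: mult.assoc[symmetric])
  then show ?thesis using pos by (simp add: mu_def field_simps)
qed

text \<open>The factor 1/4 comes from halving both \<open>a\<close> and \<open>1 - a\<close>; the
  powers of n cancel because r^2 is at least \<epsilon>^2 n while the degree factor is at most
  n^2.\<close>

lemma mu_shadow_inter_ge: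
  assumes A: "\<A> \<subseteq> layer n k" and "\<A> \<noteq> {}" "\<A> \<noteq> layer n k"
    and kr: "k + r \<le> n" and r: "r \<ge> 1" and eps: "0 < \<epsilon>" "\<epsilon> < 1" "\<epsilon> * sqrt (real n) \<le> real r"
  defines "a \<equiv> mu n k \<A>"
  shows "mu n (k + r) (upper_shadow n k r \<A> \<inter> upper_shadow n k r (layer n k - \<A>))
    \<ge> \<epsilon>\<^sup>2 / 4 * (a * (1 - a))"
proof -
  let ?L = "layer n (k + r)"
  let ?S = "upper_shadow n k r \<A>" and ?T = "upper_shadow n k r (layer n k - \<A>)"
  define w where "w = mu n (k + r) (?S \<inter> ?T)"
  define U V where "U = ?L - ?T" and "V = ?L - ?S"
  define N where "N = real (n choose (k + r))"
  have N: "N > 0" using kr by (simp add: N_def)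
  have finA: "finite \<A>" using A by (auto intro: finite_subset)
  have fin: "finite ?S" "finite ?T" by (auto simp: upper_shadow_def)
  have sub: "?S \<subseteq> ?L" "?T \<subseteq> ?L" by (auto simp: upper_shadow_def)
  \<comment> \<open>Every set of the upper layer has a k-subset, which lies in \<A> or in its
    complement. So \<open>U\<close>, \<open>V\<close> and the intersection of the shadows partition
    the layer.\<close>
  have cover: "?S \<union> ?T = ?L"
  proof -
    have "B \<in> ?S \<union> ?T" if "B \<in> ?L" for B
    proof -
      have "card {S \<in> layer n k. S \<subseteq> B} > 0" using card_layer_below[OF that, of k] by simp
      then obtain S where "S \<in> layer n k" "S \<subseteq> B" by (auto simp: card_gt_0_iff)
      then show ?thesis using that by (auto simp: upper_shadow_def)
    qed
    then show ?thesis using sub by blast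
  qed
  have L: "n choose k > 0" using kr by simp
  have cA: "card (layer n k - \<A>) = (n choose k) - card \<A>" "card \<A> < n choose k" "card \<A> > 0"
  proof -
    show "card (layer n k - \<A>) = (n choose k) - card \<A>"
      using A finA by (simp add: card_Diff_subset)
    have "card \<A> < card (layer n k)" using A assms by (intro psubset_card_mono) auto
    then show "card \<A> < n choose k" by simp
    show "card \<A> > 0" using assms finA by (simp add: card_gt_0_iff)
  qed
  have a: "0 < a" "a < 1" and ac: "mu n k (layer n k - \<A>) = 1 - a"
    using cA L by (auto simp: a_def mu_def of_nat_diff field_simps)
  have "a \<le> mu n (k + r) ?S" unfolding a_def by (rule mu_upper_shadow_ge[OF A kr])
  moreover have "1 - a \<le> mu n (k + r) ?T"
    unfolding ac[symmetric] by (rule mu_upper_shadow_ge[OF _ kr]) auto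
  ultimately have S: "a * N \<le> real (card ?S)" "(1 - a) * N \<le> real (card ?T)"
    using N by (auto simp: mu_def N_def field_simps)
  have "?S = U \<union> (?S \<inter> ?T)" "?T = V \<union> (?S \<inter> ?T)"
    using cover by (auto simp: U_def V_def)
  then have "card ?S \<le> card U + card (?S \<inter> ?T)" "card ?T \<le> card V + card (?S \<inter> ?T)"
    by (metis card_Un_le)+
  then have "real (card ?S) \<le> real (card U) + real (card (?S \<inter> ?T))"
    "real (card ?T) \<le> real (card V) + real (card (?S \<inter> ?T))"
    by (metis of_nat_add of_nat_le_iff)+
  moreover have wN: "real (card (?S \<inter> ?T)) = w * N" using N by (simp add: w_def mu_def N_def)
  ultimately have UV: "(a - w) * N \<le> real (card U)" "(1 - a - w) * N \<le> real (card V)"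
    using S by (auto simp: algebra_simps)
  have aa: "a * (1 - a) > 0" "a * (1 - a) \<le> a" "a * (1 - a) \<le> 1 - a"
    using a by (auto simp: mult_le_cancel_left1 mult_le_cancel_right1)
  have e2: "\<epsilon>\<^sup>2 \<le> 1" using eps by (simp add: power_le_one)
  have "w \<ge> \<epsilon>\<^sup>2 / 4 * (a * (1 - a))"
  \<comment> \<open>If \<open>w\<close> is large, the claim is immediate from \<epsilon>^2 \<le> 1.
    Otherwise \<open>w\<close> is at most a/2 and at most (1 - a)/2, so \<open>U\<close> and
    \<open>V\<close> keep at least half of the measures of \<A> and its complement.\<close>
  proof (cases "w \<le> a * (1 - a) / 2")
    case False
    have "\<epsilon>\<^sup>2 / 4 * (a * (1 - a)) \<le> 1 / 4 * (a * (1 - a))"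
      using aa e2 by (intro mult_right_mono) auto
    then show ?thesis using False aa by linarith
  next
    case True
    have "a / 2 * N \<le> (a - w) * N" "(1 - a) / 2 * N \<le> (1 - a - w) * N"
      using True aa N by (auto intro!: mult_right_mono)
    then have U: "a / 2 * N \<le> real (card U)" and V: "(1 - a) / 2 * N \<le> real (card V)"
      using UV by linarith+
    have "a / 2 * N > 0" "(1 - a) / 2 * N > 0" using a N by simp_all
    then have "card U > 0" "card V > 0" using U V by linarith+
    then have ne: "U \<noteq> {}" "V \<noteq> {}" by auto
    have sep: "card (v - u) > r" if uv: "u \<in> U" "v \<in> V" for u v
    proof (rule ccontr)
      assume "\<not> card (v - u) > r"
      moreover have "v \<in> ?L" using uv by (simp add: V_def)
      then have "card v = card (v \<inter> u) + card (v - u)" "card v = k + r"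
        by (rule card_Int_Diff[OF finite_mem_layer]) (use \<open>v \<in> ?L\<close> in \<open>simp add: layer_def\<close>)
      ultimately have "k \<le> card (v \<inter> u)" by linarith
      then obtain S where S: "S \<subseteq> v \<inter> u" "card S = k"
        by (rule obtain_subset_with_card_n)
      then have "S \<in> layer n k" using uv by (auto simp: layer_def V_def)
      \<comment> \<open>The common subset puts \<open>v\<close> in the shadow of \<A> or
        \<open>u\<close> in the shadow of the complement; both are excluded.\<close>
      then have "S \<in> \<A> \<or> S \<in> layer n k - \<A>" by blast
      then have "v \<in> ?S \<or> u \<in> ?T" using uv S by (auto simp: U_def V_def upper_shadow_def)
      then show False using uv by (simp add: U_def V_def)
    qed
    \<comment> \<open>\<open>separated_sets_le\<close> speaks of layer Suc k, so its index is k + r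
      - 1.\<close>
    obtain j where j: "k + r = Suc j" using r by (cases "k + r") auto
    have W: "?L - U - V = ?S \<inter> ?T" using cover by (auto simp: U_def V_def)
    have UVW: "real n * (real (card U) * real (card V)) * (real r)\<^sup>2
      \<le> real (Suc j) * real (n - j) * (w * N) * N"
      using separated_sets_le[of j n r U V] sep ne kr r
      unfolding j[symmetric] W wN N_def by (simp add: U_def V_def)
    have prod: "a / 2 * N * ((1 - a) / 2 * N) \<le> real (card U) * real (card V)"
      using U V a N by (intro mult_mono) auto
    have r2: "\<epsilon>\<^sup>2 * real n \<le> (real r)\<^sup>2"
      using power_mono[OF eps(3), of 2] eps by (simp add: power_mult_distrib)
    have "Suc j * (n - j) \<le> n * n"
      using kr j by (intro mult_le_mono) auto
    then have deg: "real (Suc j) * real (n - j) \<le> real n * real n"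
      by (metis of_nat_mult of_nat_le_iff)
    have "w \<ge> 0" by (simp add: w_def mu_def)
    have "real n * (a / 2 * N * ((1 - a) / 2 * N)) * (\<epsilon>\<^sup>2 * real n)
      \<le> real n * (real (card U) * real (card V)) * (real r)\<^sup>2"
      by (intro mult_mono[OF mult_left_mono[OF prod] r2]) auto
    also note UVW
    also have "real (Suc j) * real (n - j) * (w * N) * N \<le> real n * real n * (w * N) * N"
      using \<open>w \<ge> 0\<close> N by (intro mult_right_mono deg) auto
    finally have "real n * (a / 2 * N * ((1 - a) / 2 * N)) * (\<epsilon>\<^sup>2 * real n)
       \<le> real n * real n * (w * N) * N" .
    then have "(real n * real n * N * N) * (\<epsilon>\<^sup>2 / 4 * (a * (1 - a))) \<le> (real n * real n * N * N) * w"
      by (simp add: field_simps)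
    moreover have "real n * real n * N * N > 0" using N kr r by simp
    ultimately show ?thesis by (metis mult_le_cancel_left_pos)
  qed
  then show ?thesis by (simp add: w_def)
qed

section \<open>Choice of the constants and the final bound\<close>

theorem theorem1:
  shows "\<exists>C::real>0. \<exists>c::real>0. \<forall>(\<epsilon>::real) (n::nat) (\<A>::nat set set).
    0 < \<epsilon> \<and> \<epsilon> < 1 \<and> even n \<and> n > 0 \<and>
    \<A> \<subseteq> layer n (n div 2) \<and> \<A> \<noteq> {} \<and> \<A> \<noteq> layer n (n div 2) \<and>
    real n \<ge> C / \<epsilon>\<^sup>2 * (ln (1 / \<epsilon>) +
        ln (1 / (mu n (n div 2) \<A> * (1 - mu n (n div 2) \<A>))))
    \<longrightarrow>
    (let r = nat \<lceil>\<epsilon> * sqrt (real n)\<rceil>;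
         \<mu>A = mu n (n div 2) \<A>;
         \<A>c = layer n (n div 2) - \<A>
     in mu n (n div 2 + r)
          (upper_shadow n (n div 2) r \<A> \<inter> upper_shadow n (n div 2) r \<A>c)
        \<ge> c * \<epsilon>\<^sup>2 / ln (1 / (\<epsilon> * \<mu>A * (1 - \<mu>A))) * \<mu>A * (1 - \<mu>A))"
\<comment> \<open>C = 9 forces n \<ge> 9, which keeps the layer n/2 + r inside [n]; c = 1/4 is the
  constant of \<open>mu_shadow_inter_ge\<close>.\<close>
proof (rule exI[of _ "9::real"], rule conjI, simp, rule exI[of _ "1/4::real"], rule conjI, simp,
    intro allI impI)
  fix \<epsilon> :: real and n :: nat and \<A> :: "nat set set"
  define k where "k = n div 2"
  define a where "a = mu n k \<A>"
  define r where "r = nat \<lceil>\<epsilon> * sqrt (real n)\<rceil>"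
  assume "0 < \<epsilon> \<and> \<epsilon> < 1 \<and> even n \<and> n > 0 \<and>
    \<A> \<subseteq> layer n (n div 2) \<and> \<A> \<noteq> {} \<and> \<A> \<noteq> layer n (n div 2) \<and>
    real n \<ge> 9 / \<epsilon>\<^sup>2 * (ln (1 / \<epsilon>) +
        ln (1 / (mu n (n div 2) \<A> * (1 - mu n (n div 2) \<A>))))"
  then have eps: "0 < \<epsilon>" "\<epsilon> < 1" and n: "even n" "n > 0"
    and A: "\<A> \<subseteq> layer n k" "\<A> \<noteq> {}" "\<A> \<noteq> layer n k"
    and big: "real n \<ge> 9 / \<epsilon>\<^sup>2 * (ln (1 / \<epsilon>) + ln (1 / (a * (1 - a))))"
    by (auto simp: k_def a_def)
  have "card \<A> < card (layer n k)" using A by (intro psubset_card_mono) auto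
  moreover have "card \<A> > 0" using A by (auto simp: card_gt_0_iff intro: finite_subset)
  ultimately have a: "0 < a" "a < 1"
    by (auto simp: a_def mu_def intro!: divide_pos_pos simp del: zero_less_binomial_iff)
  then have aa: "a * (1 - a) > 0" by simp
  \<comment> \<open>From a(1 - a) \<le> 1/4 the reciprocal is at least 3 \<ge> e, so its logarithm
    is at least 1.\<close>
  have "0 \<le> (1 - 2 * a)\<^sup>2" by simp
  then have "a * (1 - a) \<le> 1 / 4" by (simp add: power2_eq_square algebra_simps)
  then have inv: "3 \<le> 1 / (a * (1 - a))" using aa by (simp add: field_simps)
  have "exp 1 \<le> 1 / (a * (1 - a))" using inv exp_le by linarith
  then have ln1: "1 \<le> ln (1 / (a * (1 - a)))" using aa by (subst ln_ge_iff) auto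
  have lne: "0 \<le> ln (1 / \<epsilon>)" using eps by simp
  have split: "ln (1 / (\<epsilon> * a * (1 - a))) = ln (1 / \<epsilon>) + ln (1 / (a * (1 - a)))"
    using eps a by (simp add: ln_div ln_mult)
  have "9 * 1 \<le> 9 / \<epsilon>\<^sup>2 * (ln (1 / \<epsilon>) + ln (1 / (a * (1 - a))))"
  proof (rule mult_mono)
    show "9 \<le> 9 / \<epsilon>\<^sup>2" using eps by (simp add: field_simps power_le_one)
    show "1 \<le> ln (1 / \<epsilon>) + ln (1 / (a * (1 - a)))" using lne ln1 by linarith
  qed auto
  then have "real n \<ge> 9" using big by simp
  then have s3: "sqrt (real n) \<ge> 3" by (intro real_le_rsqrt) simp
  have r1: "\<epsilon> * sqrt (real n) \<le> real r" unfolding r_def by (simp add: real_nat_ceiling_ge)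
  have es: "0 < \<epsilon> * sqrt (real n)" using eps n by simp
  have r: "r \<ge> 1" using r1 es by (cases r) auto
  have "real r < \<epsilon> * sqrt (real n) + 1" unfolding r_def using es by linarith
  also have "\<epsilon> * sqrt (real n) \<le> sqrt (real n)" using eps by (simp add: mult_left_le_one_le)
  \<comment> \<open>With s = sqrt n \<ge> 3, n/2 is at least 3s/2, which is at least s + 1.\<close>
  also have "sqrt (real n) + 1 \<le> real n / 2"
  proof -
    have "3 * sqrt (real n) \<le> sqrt (real n) * sqrt (real n)" using s3 by (intro mult_right_mono) auto
    then show ?thesis using s3 by simp
  qed
  finally have "2 * r < n" by simp
  then have kr: "k + r \<le> n" unfolding k_def by linarith
  let ?M = "mu n (k + r) (upper_shadow n k r \<A> \<inter> upper_shadow n k r (layer n k - \<A>))"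
  have "1 / 4 * \<epsilon>\<^sup>2 / ln (1 / (\<epsilon> * a * (1 - a))) * a * (1 - a)
      = \<epsilon>\<^sup>2 / 4 * (a * (1 - a)) / ln (1 / (\<epsilon> * a * (1 - a)))"
    by simp
  \<comment> \<open>The logarithm is at least 1, so dividing by it only weakens the bound.\<close>
  also have "\<dots> \<le> \<epsilon>\<^sup>2 / 4 * (a * (1 - a)) / 1"
  proof (rule divide_left_mono)
    show L: "1 \<le> ln (1 / (\<epsilon> * a * (1 - a)))" using split lne ln1 by linarith
    show "0 < ln (1 / (\<epsilon> * a * (1 - a))) * 1" using L by linarith
    show "0 \<le> \<epsilon>\<^sup>2 / 4 * (a * (1 - a))" using aa by simp
  qed
  also have "\<dots> \<le> ?M"
    using mu_shadow_inter_ge[OF A kr r eps r1] by (simp add: a_def)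
  finally show "let r = nat \<lceil>\<epsilon> * sqrt (real n)\<rceil>; \<mu>A = mu n (n div 2) \<A>;
         \<A>c = layer n (n div 2) - \<A>
     in mu n (n div 2 + r)
          (upper_shadow n (n div 2) r \<A> \<inter> upper_shadow n (n div 2) r \<A>c)
        \<ge> 1 / 4 * \<epsilon>\<^sup>2 / ln (1 / (\<epsilon> * \<mu>A * (1 - \<mu>A))) * \<mu>A * (1 - \<mu>A)"
    by (simp add: Let_def k_def a_def r_def)
qed

end
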